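(* Let $a,b,c\in\mathbb{C}$ and let $X_{a,b,c}$ be the vector field on $\mathbb{C}^3$, with coordinates $(x,y_1,y_2)$, defined by $$X_{a,b,c}= x^2 \frac{\partial}{\partial x} + (1+ax)\left[ y_1\frac{\partial}{\partial y_1}- y_2 \frac{\partial}{\partial y_2} \right] + b\,x\,y_2\frac{\partial}{\partial y_1} + c\,x\,y_1\frac{\partial}{\partial y_2}.$$ Assume that $$\cos (2\pi a) \neq \cos \left(2\pi\sqrt{a^2+bc}\right).$$ Then $X_{a,b,c}$ possesses no non-constant holomorphic first integral at the origin of $\mathbb{C}^3$, but it does possess a non-constant formal first integral at the origin.
   Context: A holomorphic first integral of a holomorphic vector field $X$ on $(\mathbb{C}^3,0)$ is a holomorphic function germ $f$ at $0\in\mathbb{C}^3$ (a convergent power series in $(x,y_1,y_2)$) with $X(f)=0$, where $X$ acts as a derivation. A formal first integral is a formal power series $\hat f\in\mathbb{C}[[x,y_1,y_2]]$ with $X(\hat f)=0$, where $X$ acts as a derivation on formal power series. Since cosine is even, $\cos(2\pi\sqrt{a^2+bc})$ does not depend on the choice of square root. *)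

theory Defs
  imports "HOL-Complex_Analysis.Complex_Analysis" "HOL-Computational_Algebra.Formal_Power_Series"
begin

text \<open>
  The ring of formal power series in \<open>(x, y\<^sub>1, y\<^sub>2)\<close> over the complex numbers is represented by
  iterated univariate power series: the outermost indeterminate is \<open>x\<close>, the middle one is \<open>y\<^sub>1\<close>,
  the innermost one is \<open>y\<^sub>2\<close>. So \<open>F $ i $ j $ k\<close> is the coefficient of
  \<open>x\<^sup>i y\<^sub>1\<^sup>j y\<^sub>2\<^sup>k\<close>, and addition and multiplication are the library ones.
\<close>

type_synonym series3 = "complex fps fps fps"

definition const3 :: "complex \<Rightarrow> series3" where
  "const3 c = fps_const (fps_const (fps_const c))"

definition var_x :: series3 where
  "var_x = fps_X"

definition var_y1 :: series3 where
  "var_y1 = fps_const fps_X"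

definition var_y2 :: series3 where
  "var_y2 = fps_const (fps_const fps_X)"

definition d_x :: "series3 \<Rightarrow> series3" where
  "d_x F = fps_deriv F"

definition d_y1 :: "series3 \<Rightarrow> series3" where
  "d_y1 F = Abs_fps (\<lambda>i. fps_deriv (F $ i))"

definition d_y2 :: "series3 \<Rightarrow> series3" where
  "d_y2 F = Abs_fps (\<lambda>i. Abs_fps (\<lambda>j. fps_deriv (F $ i $ j)))"

definition is_constant :: "series3 \<Rightarrow> bool" where
  "is_constant F \<longleftrightarrow> (\<exists>c. F = const3 c)"

text \<open>
  Germs at the origin of holomorphic functions are the series that converge (absolutely) on some
  polydisc centred at the origin; there is no loss in taking all three radii equal.
\<close>

definition convergent3 :: "series3 \<Rightarrow> bool" where
  "convergent3 F \<longleftrightarrow> (\<exists>r>0. (\<lambda>(i, j, k). norm (F $ i $ j $ k) * r ^ (i + j + k)) summable_on UNIV)"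

text \<open>
  A triple \<open>(P, Q\<^sub>1, Q\<^sub>2)\<close> stands for the vector field
  \<open>P \<partial>/\<partial>x + Q\<^sub>1 \<partial>/\<partial>y\<^sub>1 + Q\<^sub>2 \<partial>/\<partial>y\<^sub>2\<close>.
\<close>

type_synonym vector_field3 = "series3 \<times> series3 \<times> series3"

definition derivation :: "vector_field3 \<Rightarrow> series3 \<Rightarrow> series3" where
  "derivation X F = (case X of (P, Q1, Q2) \<Rightarrow> P * d_x F + Q1 * d_y1 F + Q2 * d_y2 F)"

definition formal_first_integral :: "vector_field3 \<Rightarrow> series3 \<Rightarrow> bool" where
  "formal_first_integral X F \<longleftrightarrow> derivation X F = 0"

definition holomorphic_first_integral :: "vector_field3 \<Rightarrow> series3 \<Rightarrow> bool" where
  "holomorphic_first_integral X F \<longleftrightarrow> convergent3 F \<and> derivation X F = 0"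

definition X_field :: "complex \<Rightarrow> complex \<Rightarrow> complex \<Rightarrow> vector_field3" where
  "X_field a b c =
    (var_x ^ 2,
     (1 + const3 a * var_x) * var_y1 + const3 b * var_x * var_y2,
     - ((1 + const3 a * var_x) * var_y2) + const3 c * var_x * var_y1)"

end

theory Submission
  imports Defs
begin

text \<open>
  The field is linear in \<open>y\<close>, so its first integrals are governed by the system
  \<open>x\<^sup>2 y' = A(x) y\<close>, whose two formal solutions \<open>x\<^sup>a e\<^bsup>-1/x\<^esup> (u, v)\<close> and
  \<open>x\<^bsup>-a\<^esup> e\<^bsup>1/x\<^esup> (p, q)\<close> give the formal first integral
  \<open>h = (u y\<^sub>2 - v y\<^sub>1) (q y\<^sub>1 - p y\<^sub>2)\<close>. In the coordinates given by the two linear factors, a first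
  integral that is homogeneous of degree \<open>d\<close> in \<open>y\<close> is a constant multiple of \<open>h\<^sup>m\<close> with \<open>d = 2 m\<close>.
  If it converges, then so does \<open>h\<close>, as a root of a convergent series at each of three points
  \<open>y\<close>, and hence \<open>u\<close>, which solves a first-order linear equation whose coefficient
  is built from \<open>h\<close>. But the coefficients of \<open>u\<close> satisfy
  \<open>2 (n + 1) u\<^bsub>n+1\<^esub> = - ((n + a)\<^sup>2 - (a\<^sup>2 + b c)) u\<^bsub>n\<^esub>\<close>; the cosine condition says that
  the factor on the right never vanishes for \<open>n \<ge> 0\<close>, so that \<open>u\<close> diverges by the ratio test.
\<close>

section \<open>Positive radius of convergence of univariate power series\<close>

lemma fps_conv_radius_pos_combine:
  fixes f g :: "complex fps"
  assumes "fps_conv_radius f > 0" "fps_conv_radius g > 0"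
  shows "fps_conv_radius (f + g) > 0" "fps_conv_radius (f - g) > 0" "fps_conv_radius (f * g) > 0"
  using assms fps_conv_radius_add[of f g] fps_conv_radius_diff[of f g] fps_conv_radius_mult[of f g]
  by (auto simp: min_def split: if_splits)

lemma fps_conv_radius_pos_sum:
  fixes f :: "'i \<Rightarrow> complex fps"
  assumes "\<And>i. i \<in> I \<Longrightarrow> fps_conv_radius (f i) > 0"
  shows "fps_conv_radius (sum f I) > 0"
  using assms
  by (induction I rule: infinite_finite_induct) (auto intro: fps_conv_radius_pos_combine)

lemma fps_conv_radius_posI:
  fixes f :: "complex fps"
  assumes "\<And>n. norm (fps_nth f n) \<le> B * M ^ n" and "M > 0"
  shows "fps_conv_radius f > 0"
proof -
  have "summable (\<lambda>n. fps_nth f n * of_real (1 / (2 * M)) ^ n)"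
  proof (rule summable_comparison_test')
    show "summable (\<lambda>n. B * (1 / 2) ^ n)"
      by (intro summable_mult summable_geometric) auto
    fix n
    have "norm (fps_nth f n * of_real (1 / (2 * M)) ^ n) = norm (fps_nth f n) * (1 / (2 * M)) ^ n"
      using assms(2) by (simp add: norm_mult norm_power norm_divide)
    also have "\<dots> \<le> B * M ^ n * (1 / (2 * M)) ^ n"
      using assms by (intro mult_right_mono) auto
    also have "\<dots> = B * (1 / 2) ^ n"
      using assms(2) by (simp add: power_mult_distrib power_divide)
    finally show "norm (fps_nth f n * of_real (1 / (2 * M)) ^ n) \<le> B * (1 / 2) ^ n" .
  qed
  from conv_radius_geI[OF this] have "ereal (1 / (2 * M)) \<le> fps_conv_radius f"
    using assms(2) by (simp add: fps_conv_radius_def norm_divide norm_mult)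
  moreover have "0 < ereal (1 / (2 * M))" using assms(2) by simp
  ultimately show ?thesis by (rule less_le_trans[rotated])
qed

text \<open>One constant \<open>M\<close> serves as factor and as ratio; the spare power of
  \<open>M\<close> closes the induction in \<open>fps_conv_radius_pos_linear_ode\<close>.\<close>

lemma fps_conv_radius_posE:
  fixes f :: "complex fps"
  assumes "fps_conv_radius f > 0"
  obtains M where "M \<ge> 1" "\<And>n. norm (fps_nth f n) \<le> M * M ^ n"
proof -
  from ereal_dense2[OF assms] obtain r where r: "0 < ereal r" "ereal r < fps_conv_radius f" by blast
  have "summable (\<lambda>n. norm (fps_nth f n * of_real r ^ n))"
    by (rule norm_summable_fps) (use r in auto)
  then have "Bseq (\<lambda>n. norm (fps_nth f n * of_real r ^ n))"
    by (rule summable_LIMSEQ_zero[THEN convergentI, THEN convergent_imp_Bseq])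
  then obtain K where K: "\<And>n. norm (fps_nth f n) * r ^ n \<le> K"
    using r by (auto simp: Bseq_def norm_mult norm_power)
  define M where "M = max 1 (max K (1 / r))"
  have "norm (fps_nth f n) \<le> M * M ^ n" for n
  proof -
    have "norm (fps_nth f n) = norm (fps_nth f n) * r ^ n * (1 / r) ^ n"
      using r by (simp add: power_divide)
    also have "\<dots> \<le> M * M ^ n"
      using r K[of n] by (intro mult_mono power_mono) (auto simp: M_def)
    finally show ?thesis .
  qed
  then show ?thesis by (intro that[of M]) (auto simp: M_def)
qed

text \<open>The function given by \<open>g ^ m\<close> is nonzero near 0, so it has a holomorphic
  m-th root with value \<open>fps_nth g 0\<close> at 0. Its expansion must be \<open>g\<close>,
  since a power series root is fixed by its nonzero constant term.\<close>

lemma fps_conv_radius_pos_root: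
  fixes g :: "complex fps"
  assumes conv: "fps_conv_radius (g ^ m) > 0" and "m > 0" and g0: "fps_nth g 0 \<noteq> 0"
  shows "fps_conv_radius g > 0"
proof -
  define F where "F = g ^ m"
  define f where "f = eval_fps F"
  have f0: "f 0 = fps_nth g 0 ^ m"
    by (simp add: f_def F_def eval_fps_at_0 fps_power_zeroth)
  have f_exp: "f has_fps_expansion F"
    unfolding f_def using conv by (intro eval_fps_has_fps_expansion) (simp add: F_def)
  have an: "f analytic_on {0}"
    using f_exp by (rule has_fps_expansion_imp_analytic_0)
  \<comment> \<open>Dividing by \<open>f 0\<close> puts the argument of \<open>Ln\<close> at 1 for z
    = 0, away from the branch cut; the prefactor selects the root with the constant term of
    \<open>g\<close>.\<close>
  define r where "r = (\<lambda>z. fps_nth g 0 * exp (Ln (f z / f 0) / of_nat m))"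
  have "r analytic_on {0}"
    unfolding r_def using f0 g0 \<open>m > 0\<close> by (auto intro!: analytic_intros an)
  then obtain R where R: "r has_fps_expansion R"
    using analytic_at_imp_has_fps_expansion_0 by blast
  have "eventually (\<lambda>z. f z \<noteq> 0) (nhds 0)"
    using has_fps_expansion_imp_continuous[OF f_exp, of UNIV] f0 g0
    by (intro tendsto_imp_eventually_ne[of f "f 0"]) (auto simp: isCont_def continuous_at_imp_continuous_within tendsto_nhds_iff)
  then have "eventually (\<lambda>z. r z ^ m = f z) (nhds 0)"
  proof eventually_elim
    case (elim z)
    have "r z ^ m = f 0 * exp (Ln (f z / f 0))"
      using \<open>m > 0\<close> by (simp add: r_def power_mult_distrib f0 flip: exp_of_nat_mult)
    then show ?case using elim f0 g0 by simp
  qed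
  then have "f has_fps_expansion (R ^ m)"
    using has_fps_expansion_cong[of "\<lambda>z. r z ^ m" f "R ^ m" "R ^ m"] has_fps_expansion_power[OF R, of m] by blast
  then have RF: "R ^ m = g ^ m"
    using fps_expansion_unique_complex[OF f_exp] unfolding F_def by simp
  have R0: "fps_nth R 0 = fps_nth g 0"
    using has_fps_expansion_imp_0_eq_fps_nth_0[OF R] f0 g0 by (simp add: r_def)
  \<comment> \<open>The cofactor of \<open>g - R\<close> in \<open>g ^ m - R ^ m\<close> has
    constant term m g_0^(m-1), which is nonzero, so \<open>g - R\<close> itself must vanish.\<close>
  have "(g - R) * (\<Sum>i<m. R ^ (m - Suc i) * g ^ i) = 0"
    using RF power_diff_sumr2[of g m R] by simp
  moreover have "fps_nth (\<Sum>i<m. R ^ (m - Suc i) * g ^ i) 0 = of_nat m * fps_nth g 0 ^ (m - 1)"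
  proof -
    have "fps_nth g 0 ^ (m - Suc i) * fps_nth g 0 ^ i = fps_nth g 0 ^ (m - 1)" if "i < m" for i
      using that by (simp flip: power_add)
    then show ?thesis by (simp add: fps_sum_nth fps_power_zeroth R0)
  qed
  then have "(\<Sum>i<m. R ^ (m - Suc i) * g ^ i) \<noteq> 0"
    using g0 \<open>m > 0\<close> by auto
  ultimately have "g = R" by simp
  then show ?thesis
    using R by (simp add: has_fps_expansion_def)
qed

text \<open>Majorant argument: n u_n is a sum of n products of a coefficient of \<open>W\<close>
  with an earlier coefficient of \<open>u\<close>, each bounded by |u_0| M^n.\<close>

lemma fps_conv_radius_pos_linear_ode:
  fixes u W :: "complex fps"
  assumes ode: "fps_deriv u = W * u" and conv: "fps_conv_radius W > 0"
  shows "fps_conv_radius u > 0"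
proof -
  obtain M where M: "M \<ge> 1" "\<And>n. norm (fps_nth W n) \<le> M * M ^ n"
    using fps_conv_radius_posE[OF conv] by blast
  have "norm (fps_nth u n) \<le> norm (fps_nth u 0) * M ^ n" for n
  proof (induction n rule: less_induct)
    case (less n)
    show ?case
    proof (cases n)
      case (Suc k)
      have "of_nat n * fps_nth u n = fps_nth (fps_deriv u) k"
        by (simp add: Suc)
      also have "\<dots> = (\<Sum>i=0..k. fps_nth W i * fps_nth u (k - i))"
        by (simp add: ode fps_mult_nth)
      finally have "real n * norm (fps_nth u n) = norm (\<Sum>i=0..k. fps_nth W i * fps_nth u (k - i))"
        by (metis norm_mult norm_of_nat)
      also have "\<dots> \<le> (\<Sum>i=0..k. norm (fps_nth u 0) * M ^ n)"
      proof (rule sum_norm_le)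
        fix i assume i: "i \<in> {0..k}"
        have "norm (fps_nth W i * fps_nth u (k - i)) \<le> (M * M ^ i) * (norm (fps_nth u 0) * M ^ (k - i))"
          unfolding norm_mult using M i Suc by (intro mult_mono less.IH) auto
        also have "\<dots> = norm (fps_nth u 0) * M ^ n"
          using i Suc by (simp flip: power_add)
        finally show "norm (fps_nth W i * fps_nth u (k - i)) \<le> norm (fps_nth u 0) * M ^ n" .
      qed
      also have "\<dots> = real n * (norm (fps_nth u 0) * M ^ n)"
        by (simp add: Suc)
      finally show ?thesis by (simp add: Suc del: of_nat_Suc)
    qed simp
  qed
  then show ?thesis
    using M(1) by (intro fps_conv_radius_posI) auto
qed

section \<open>The divergent formal solutions\<close>

text \<open>
  For \<open>s = 1\<close> this is \<open>u\<close>, and for \<open>s = -1\<close> it is \<open>q\<close>.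
\<close>

definition formal_sol :: "complex \<Rightarrow> complex \<Rightarrow> complex \<Rightarrow> complex fps" where
  "formal_sol s a bc =
     Abs_fps (\<lambda>n. \<Prod>k<n. s * (bc - 2 * s * a * of_nat k - of_nat k ^ 2) / (2 * (of_nat k + 1)))"

lemma formal_sol_nth_0 [simp]: "fps_nth (formal_sol s a bc) 0 = 1"
  by (simp add: formal_sol_def)

lemma formal_sol_nth_Suc:
  "fps_nth (formal_sol s a bc) (Suc n) =
     s * (bc - 2 * s * a * of_nat n - of_nat n ^ 2) / (2 * (of_nat n + 1)) * fps_nth (formal_sol s a bc) n"
  by (simp add: formal_sol_def)

lemma formal_sol_recurrence:
  "2 * (of_nat n + 1) * fps_nth (formal_sol s a bc) (Suc n) =
     s * (bc - 2 * s * a * of_nat n - of_nat n ^ 2) * fps_nth (formal_sol s a bc) n"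
proof -
  have "2 * (of_nat n + 1) \<noteq> (0 :: complex)"
    by (metis add.commute mult_eq_0_iff of_nat_Suc of_nat_neq_0 zero_neq_numeral)
  then show ?thesis
    by (simp only: formal_sol_nth_Suc) (simp del: mult_eq_0_iff)
qed

text \<open>For s = 1 this second-order equation results from eliminating \<open>v\<close> from the
  system for (u, v), for s = -1 from eliminating \<open>p\<close> from that for (p, q).\<close>

lemma formal_sol_ode:
  fixes s a bc :: complex
  assumes s: "s * s = 1"
  defines "U \<equiv> formal_sol s a bc"
  shows "fps_X ^ 2 * fps_deriv (fps_X * fps_deriv U) =
         fps_const bc * fps_X * U - fps_const (2 * s) * (1 + fps_const a * fps_X) * (fps_X * fps_deriv U)"
proof -
  \<comment> \<open>With one factor x cancelled, comparing coefficients of order n gives the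
    recurrence; \<open>s * s = 1\<close> removes the sign it carries.\<close>
  have "fps_X * fps_deriv (fps_X * fps_deriv U) =
        fps_const bc * U - fps_const (2 * s * a) * (fps_X * fps_deriv U) - fps_const (2 * s) * fps_deriv U"
    (is "?L = ?R")
  proof (rule fps_ext)
    fix n
    have "fps_nth ?R n = bc * fps_nth U n - 2 * s * a * of_nat n * fps_nth U n
        - s * (2 * (of_nat n + 1) * fps_nth U (Suc n))"
      by (cases n) (auto simp: mult.assoc add.commute)
    also have "\<dots> = bc * fps_nth U n - 2 * s * a * of_nat n * fps_nth U n
        - s * (s * (bc - 2 * s * a * of_nat n - of_nat n ^ 2) * fps_nth U n)"
      by (simp only: U_def formal_sol_recurrence)
    also have "\<dots> = bc * fps_nth U n - 2 * s * a * of_nat n * fps_nth U n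
        - s * s * (bc - 2 * s * a * of_nat n - of_nat n ^ 2) * fps_nth U n"
      by (simp only: mult.assoc)
    also have "\<dots> = of_nat n ^ 2 * fps_nth U n"
      by (simp add: s algebra_simps)
    also have "\<dots> = fps_nth ?L n"
      by (cases n) (auto simp: power2_eq_square algebra_simps)
    finally show "fps_nth ?L n = fps_nth ?R n" ..
  qed
  then have "fps_X ^ 2 * fps_deriv (fps_X * fps_deriv U) = fps_X * ?R"
    by (simp add: power2_eq_square mult.assoc)
  also have "\<dots> = fps_const bc * fps_X * U - fps_const (2 * s) * (1 + fps_const a * fps_X) * (fps_X * fps_deriv U)"
    by (simp add: algebra_simps flip: fps_const_mult)
  finally show ?thesis .
qed

text \<open>Ratio test: no coefficient vanishes, and the quotient of consecutive coefficients grows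
  linearly in n.\<close>

lemma fps_conv_radius_formal_sol:
  assumes nz: "\<And>n. bc - 2 * s * a * of_nat n - of_nat n ^ 2 \<noteq> 0" and s: "s \<noteq> 0"
  shows "fps_conv_radius (formal_sol s a bc) = 0"
proof -
  let ?U = "formal_sol s a bc"
  define \<rho> where "\<rho> n = s * (bc - 2 * s * a * of_nat n - of_nat n ^ 2) / (2 * (of_nat n + 1))" for n :: nat
  have Unz: "fps_nth ?U n \<noteq> 0" for n
  proof (induction n)
    case (Suc n)
    then show ?case using nz[of n] s formal_sol_recurrence[of n s a bc] by fastforce
  qed simp
  have "(\<lambda>n. norm (fps_nth ?U n) / norm (fps_nth ?U (Suc n))) = (\<lambda>n. norm (inverse (\<rho> n)))"
    using Unz by (auto simp: formal_sol_nth_Suc[of s a bc, folded \<rho>_def] norm_mult norm_divide divide_simps)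
  moreover have "(\<lambda>n. norm (inverse (\<rho> n))) \<longlonglongrightarrow> 0"
  proof -
    have "(\<lambda>n. 1 / of_nat n :: complex) \<longlonglongrightarrow> 0"
      by (rule lim_1_over_n)
    \<comment> \<open>This is \<open>inverse (\<rho> n)\<close> with numerator and denominator
      divided by n^2; the denominator tends to -s, which is nonzero.\<close>
    then have "(\<lambda>n. 2 * (1 / of_nat n + (1 / of_nat n) ^ 2) /
          (s * (bc * (1 / of_nat n) ^ 2 - 2 * s * a * (1 / of_nat n) - 1))) \<longlonglongrightarrow>
        2 * (0 + 0 ^ 2) / (s * (bc * 0 ^ 2 - 2 * s * a * 0 - 1))"
      using s by (intro tendsto_intros) auto
    moreover have "eventually (\<lambda>n. 2 * (1 / of_nat n + (1 / of_nat n) ^ 2) /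
          (s * (bc * (1 / of_nat n) ^ 2 - 2 * s * a * (1 / of_nat n) - 1)) = inverse (\<rho> n)) sequentially"
      using eventually_gt_at_top[of 0]
    proof eventually_elim
      case (elim n)
      define N where "N = (of_nat n :: complex)"
      have N: "N \<noteq> 0" using elim by (simp add: N_def)
      have "inverse (\<rho> n) = (2 * (N + 1) / N ^ 2) / (s * (bc - 2 * s * a * N - N ^ 2) / N ^ 2)"
        using N by (simp add: \<rho>_def N_def)
      also have "2 * (N + 1) / N ^ 2 = 2 * (1 / N + (1 / N) ^ 2)"
        using N by (simp add: field_simps power2_eq_square)
      also have "s * (bc - 2 * s * a * N - N ^ 2) / N ^ 2 = s * (bc * (1 / N) ^ 2 - 2 * s * a * (1 / N) - 1)"
        using N by (simp add: field_simps power2_eq_square)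
      finally show ?case by (simp add: N_def)
    qed
    ultimately have "(\<lambda>n. inverse (\<rho> n)) \<longlonglongrightarrow> 0"
      by (auto dest: Lim_transform_eventually)
    then show ?thesis by (rule tendsto_norm_zero)
  qed
  ultimately have "conv_radius (fps_nth ?U) = ereal 0"
    using Unz by (intro conv_radius_ratio_limit) auto
  then show ?thesis by (simp add: fps_conv_radius_def zero_ereal_def)
qed

section \<open>Auxiliary facts on sums, polynomials and irregular equations\<close>

lemma sum_atMost_shift_index:
  fixes f :: "nat \<Rightarrow> 'a :: comm_monoid_add"
  shows "(\<Sum>j\<le>d. if j = 0 then 0 else f (j - 1)) = (\<Sum>j\<le>d. if j < d then f j else 0)"
proof -
  have "(\<Sum>j\<le>d. if j = 0 then 0 else f (j - 1)) = (\<Sum>j<d. f j)"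
    by (subst sum.atMost_shift) simp
  also have "\<dots> = (\<Sum>j\<le>d. if j < d then f j else 0)"
    by (intro sum.mono_neutral_cong_left) auto
  finally show ?thesis .
qed

lemma map_poly_fps_deriv_mult:
  fixes P Q :: "'a :: comm_ring_1 fps poly"
  shows "map_poly fps_deriv (P * Q) = map_poly fps_deriv P * Q + P * map_poly fps_deriv Q"
  by (intro poly_eqI)
    (simp add: coeff_map_poly coeff_mult fps_deriv_sum sum.distrib[symmetric] add.commute)

lemma map_poly_fps_deriv_add:
  fixes P Q :: "'a :: comm_ring_1 fps poly"
  shows "map_poly fps_deriv (P + Q) = map_poly fps_deriv P + map_poly fps_deriv Q"
  by (intro poly_eqI) (simp add: coeff_map_poly)

text \<open>The operator x^2 d/dx raises the order: at order n the left side involves only g_(n-1),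
  while the right side is k g_n plus a multiple of g_(n-1), so the coefficients vanish one after
  another.\<close>

lemma fps_irregular_ode_eq_0:
  fixes g :: "complex fps"
  assumes ode: "fps_X ^ 2 * fps_deriv g = fps_const k * (1 + fps_const a * fps_X) * g" and k: "k \<noteq> 0"
  shows "g = 0"
proof (rule fps_ext)
  fix n
  show "fps_nth g n = fps_nth 0 n"
  proof (induction n rule: less_induct)
    case (less n)
    have "fps_nth (fps_X ^ 2 * fps_deriv g) n = 0"
    proof (cases "n \<ge> 2")
      case True
      then have "Suc (n - 2) = n - 1" by simp
      then show ?thesis using True less[of "n - 1"] by (simp add: fps_X_power_mult_nth)
    qed (simp add: fps_X_power_mult_nth)
    moreover have "fps_nth (fps_const k * (1 + fps_const a * fps_X) * g) n = k * fps_nth g n"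
    proof -
      have "fps_const k * (1 + fps_const a * fps_X) * g = fps_const k * g + fps_const (k * a) * (fps_X * g)"
        by (simp add: algebra_simps flip: fps_const_mult)
      then show ?thesis using less[of "n - 1"] by auto
    qed
    ultimately show ?case using k ode by simp
  qed
qed

section \<open>The formal fundamental system\<close>

text \<open>The exponential and power prefactors are divided out, so that both columns (u, v) and
  (p, q) are power series; in the equations for \<open>u\<close> and \<open>q\<close> a factor x is
  cancelled as well.\<close>

locale formal_fundamental_solution =
  fixes a b c :: complex and u v p q :: "complex fps"
  assumes u_ode: "fps_X * fps_deriv u = fps_const b * v"
    and v_ode: "fps_X ^ 2 * fps_deriv v = fps_const c * fps_X * u - 2 * (1 + fps_const a * fps_X) * v"
    and q_ode: "fps_X * fps_deriv q = fps_const c * p"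
    and p_ode: "fps_X ^ 2 * fps_deriv p = fps_const b * fps_X * q + 2 * (1 + fps_const a * fps_X) * p"
    and init [simp]: "fps_nth u 0 = 1" "fps_nth v 0 = 0" "fps_nth p 0 = 0" "fps_nth q 0 = 1"
begin

text \<open>The system has trace zero and the prefactors of the two columns cancel, so the
  determinant is constant; its value is read off at x = 0.\<close>

lemma wronskian: "u * q - p * v = 1"
proof -
  have "fps_X ^ 2 * fps_deriv (u * q - p * v) =
      fps_X * (fps_X * fps_deriv u) * q + u * fps_X * (fps_X * fps_deriv q)
      - (fps_X ^ 2 * fps_deriv p) * v - p * (fps_X ^ 2 * fps_deriv v)"
    by (simp add: power2_eq_square algebra_simps)
  also have "\<dots> = 0"
    unfolding u_ode v_ode p_ode q_ode by (simp add: algebra_simps)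
  finally have "fps_deriv (u * q - p * v) = 0" by simp
  then have "u * q - p * v = fps_const (fps_nth (u * q - p * v) 0)"
    by (simp only: fps_deriv_eq_0_iff)
  then show ?thesis by simp
qed

text \<open>The first integral at \<open>(y\<^sub>1, y\<^sub>2) = (y, 1)\<close>.\<close>

definition h :: "complex fps \<Rightarrow> complex fps" where
  "h y = (u - v * y) * (q * y - p)"

abbreviation (input) L :: "complex fps" where
  "L \<equiv> 1 + fps_const a * fps_X"

section \<open>The vector field in coordinates along the two solutions\<close>

text \<open>
  With \<open>S\<close> the polynomial variable, \<open>E = x\<^sup>2 \<partial>/\<partial>x + 2 (1 + a x) S \<partial>/\<partial>S\<close>. On forms of degree \<open>d\<close> evaluated
  at \<open>(Y1, Y2) = S (u, v) + (p, q)\<close>, it acts as the vector field plus \<open>d (1 + a x)\<close>.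
\<close>

definition E :: "complex fps poly \<Rightarrow> complex fps poly" where
  "E P = smult (fps_X ^ 2) (map_poly fps_deriv P) + smult (2 * L) (pCons 0 (pderiv P))"

lemma E_add: "E (P + Q) = E P + E Q"
  by (simp add: E_def map_poly_fps_deriv_add pderiv_add smult_add_right)

lemma E_sum: "E (sum P I) = (\<Sum>i\<in>I. E (P i))"
  by (induction I rule: infinite_finite_induct) (simp_all add: E_add, simp_all add: E_def)

lemma E_mult: "E (P * Q) = E P * Q + P * E Q"
proof -
  have shift: "pCons 0 R = [:0, 1:] * R" for R :: "complex fps poly"
    by simp
  show ?thesis
    unfolding E_def map_poly_fps_deriv_mult pderiv_mult
    by (subst (1 2 3) shift) (simp add: smult_add_right algebra_simps)
qed

lemma E_power: "E (P ^ n) = of_nat n * P ^ (n - 1) * E P"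
proof (induction n)
  case 0
  then show ?case by (simp add: E_def pderiv_1 poly_eq_iff coeff_map_poly)
next
  case (Suc n)
  then show ?case by (cases n) (simp_all add: E_mult algebra_simps)
qed

text \<open>\<open>E\<close> is diagonal on powers of S, so an equation
  \<open>E P = smult f P\<close> decouples into scalar first-order equations.\<close>

lemma coeff_E: "coeff (E P) k = fps_X ^ 2 * fps_deriv (coeff P k) + 2 * of_nat k * L * coeff P k"
  by (cases k) (simp_all add: E_def coeff_map_poly coeff_pCons coeff_pderiv algebra_simps)

definition Y1 :: "complex fps poly" where "Y1 = [:p, u:]"
definition Y2 :: "complex fps poly" where "Y2 = [:q, v:]"

text \<open>The shift by \<open>L\<close> per degree turns the diagonal entries \<open>L\<close> and
  \<open>- L\<close> of the linear field into \<open>2 * L\<close> and 0.\<close>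

lemma E_Y1: "E Y1 = smult (2 * L) Y1 + smult (fps_const b * fps_X) Y2"
proof (rule poly_eqI)
  fix k
  have "fps_X ^ 2 * fps_deriv u = fps_const b * fps_X * v"
    using arg_cong[OF u_ode, of "\<lambda>f. fps_X * f"] by (simp add: power2_eq_square mult_ac)
  then show "coeff (E Y1) k = coeff (smult (2 * L) Y1 + smult (fps_const b * fps_X) Y2) k"
    unfolding coeff_E by (auto simp: Y1_def Y2_def p_ode coeff_pCons split: nat.splits)
qed

lemma E_Y2: "E Y2 = smult (fps_const c * fps_X) Y1"
proof (rule poly_eqI)
  fix k
  have "fps_X ^ 2 * fps_deriv q = fps_const c * fps_X * p"
    using arg_cong[OF q_ode, of "\<lambda>f. fps_X * f"] by (simp add: power2_eq_square mult_ac)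
  then show "coeff (E Y2) k = coeff (smult (fps_const c * fps_X) Y1) k"
    unfolding coeff_E by (auto simp: Y1_def Y2_def v_ode coeff_pCons split: nat.splits)
qed

text \<open>The truncated exponents \<open>j - 1\<close> and \<open>k - 1\<close> do no harm at 0,
  since the factors \<open>of_nat j\<close> and \<open>of_nat k\<close> then vanish.\<close>

lemma E_monomial:
  "E ([:\<phi>:] * (Y1 ^ j * Y2 ^ k)) =
    [:fps_X ^ 2 * fps_deriv \<phi> + 2 * of_nat j * L * \<phi>:] * (Y1 ^ j * Y2 ^ k)
    + [:fps_const b * fps_X * of_nat j * \<phi>:] * (Y1 ^ (j - 1) * Y2 ^ Suc k)
    + [:fps_const c * fps_X * of_nat k * \<phi>:] * (Y1 ^ Suc j * Y2 ^ (k - 1))"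
proof -
  have const: "E [:\<phi>:] = [:fps_X ^ 2 * fps_deriv \<phi>:]"
    by (rule poly_eqI) (auto simp: coeff_E coeff_pCons split: nat.splits)
  have absorb: "of_nat j * Y1 ^ (j - 1) * Y1 = of_nat j * Y1 ^ j"
    by (cases j) simp_all
  have smult_of_nat: "smult (of_nat n) P = of_nat n * P" for n and P :: "complex fps poly"
    by (simp add: of_nat_poly)
  have "E (Y1 ^ j) = smult (2 * L) (of_nat j * Y1 ^ (j - 1) * Y1)
      + smult (fps_const b * fps_X) (of_nat j * Y1 ^ (j - 1) * Y2)"
    by (simp only: E_power E_Y1 distrib_left mult_smult_right)
  then have Y1: "E (Y1 ^ j) = smult (2 * of_nat j * L) (Y1 ^ j)
      + smult (fps_const b * fps_X * of_nat j) (Y1 ^ (j - 1) * Y2)"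
    unfolding absorb by (simp add: mult_ac flip: smult_of_nat)
  have Y2: "E (Y2 ^ k) = smult (fps_const c * fps_X * of_nat k) (Y1 * Y2 ^ (k - 1))"
    by (simp add: E_power E_Y2 mult_ac flip: smult_of_nat)
  have "E (Y1 ^ j * Y2 ^ k) = smult (2 * of_nat j * L) (Y1 ^ j * Y2 ^ k)
    + smult (fps_const b * fps_X * of_nat j) (Y1 ^ (j - 1) * Y2 ^ Suc k)
    + smult (fps_const c * fps_X * of_nat k) (Y1 ^ Suc j * Y2 ^ (k - 1))"
    unfolding E_mult Y1 Y2 by (simp add: algebra_simps)
  then show ?thesis
    unfolding E_mult[of "[:\<phi>:]" "Y1 ^ j * Y2 ^ k"] const
    by (simp add: smult_add_right smult_add_left algebra_simps)
qed

section \<open>Homogeneous first integrals of degree d\<close>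

text \<open>
  \<open>\<phi> j\<close> is the coefficient of \<open>y\<^sub>1\<^sup>j y\<^sub>2\<^bsup>d-j\<^esup>\<close> in a form of degree \<open>d\<close> annihilated by the vector field.
\<close>

context
  fixes \<phi> :: "nat \<Rightarrow> complex fps" and d :: nat
  assumes pde: "\<And>j. j \<le> d \<Longrightarrow>
    fps_X ^ 2 * fps_deriv (\<phi> j) + (2 * of_nat j - of_nat d) * L * \<phi> j
    + fps_const b * fps_X * (if j < d then of_nat (Suc j) * \<phi> (Suc j) else 0)
    + fps_const c * fps_X * (if j = 0 then 0 else of_nat (d - (j - 1)) * \<phi> (j - 1)) = 0"
begin

definition G :: "complex fps poly" where
  "G = (\<Sum>j\<le>d. [:\<phi> j:] * (Y1 ^ j * Y2 ^ (d - j)))"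

text \<open>By \<open>pde\<close> the vector field kills the form, so on \<open>G\<close> only the
  shift in \<open>E\<close>, d times \<open>L\<close>, remains.\<close>

lemma E_G: "E G = smult (of_nat d * L) G"
proof -
  let ?M = "\<lambda>j. Y1 ^ j * Y2 ^ (d - j)"
  \<comment> \<open>\<open>down\<close> and \<open>up\<close> reindex the contributions of
    neighbouring monomials so that those to \<open>?M j\<close> have the shape they have in
    \<open>pde\<close>.\<close>
  have down: "(\<Sum>j\<le>d. [:fps_const b * fps_X * of_nat j * \<phi> j:] * (Y1 ^ (j - 1) * Y2 ^ Suc (d - j)))
      = (\<Sum>j\<le>d. [:fps_const b * fps_X * (if j < d then of_nat (Suc j) * \<phi> (Suc j) else 0):] * ?M j)"
  proof -
    have "(\<Sum>j\<le>d. [:fps_const b * fps_X * of_nat j * \<phi> j:] * (Y1 ^ (j - 1) * Y2 ^ Suc (d - j)))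
      = (\<Sum>j\<le>d. if j = 0 then 0 else
           [:fps_const b * fps_X * of_nat (Suc (j - 1)) * \<phi> (Suc (j - 1)):] * ?M (j - 1))"
      by (intro sum.cong) (auto simp: Suc_diff_le)
    also have "\<dots> = (\<Sum>j\<le>d. if j < d then [:fps_const b * fps_X * of_nat (Suc j) * \<phi> (Suc j):] * ?M j else 0)"
      by (rule sum_atMost_shift_index)
    also have "\<dots> = (\<Sum>j\<le>d. [:fps_const b * fps_X * (if j < d then of_nat (Suc j) * \<phi> (Suc j) else 0):] * ?M j)"
      by (intro sum.cong) (auto simp: mult.assoc)
    finally show ?thesis .
  qed
  have up: "(\<Sum>j\<le>d. [:fps_const c * fps_X * of_nat (d - j) * \<phi> j:] * (Y1 ^ Suc j * Y2 ^ (d - j - 1)))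
      = (\<Sum>j\<le>d. [:fps_const c * fps_X * (if j = 0 then 0 else of_nat (d - (j - 1)) * \<phi> (j - 1)):] * ?M j)"
  proof -
    have "(\<Sum>j\<le>d. [:fps_const c * fps_X * of_nat (d - j) * \<phi> j:] * (Y1 ^ Suc j * Y2 ^ (d - j - 1)))
      = (\<Sum>j\<le>d. if j < d then [:fps_const c * fps_X * of_nat (d - j) * \<phi> j:] * ?M (Suc j) else 0)"
      by (intro sum.cong) auto
    also have "\<dots> = (\<Sum>j\<le>d. if j = 0 then 0 else
        [:fps_const c * fps_X * of_nat (d - (j - 1)) * \<phi> (j - 1):] * ?M (Suc (j - 1)))"
      by (rule sum_atMost_shift_index[symmetric])
    also have "\<dots> = (\<Sum>j\<le>d. [:fps_const c * fps_X * (if j = 0 then 0 else of_nat (d - (j - 1)) * \<phi> (j - 1)):] * ?M j)"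
      by (intro sum.cong) (auto simp: mult.assoc)
    finally show ?thesis .
  qed
  have "E G = (\<Sum>j\<le>d. [:fps_X ^ 2 * fps_deriv (\<phi> j) + 2 * of_nat j * L * \<phi> j
      + fps_const b * fps_X * (if j < d then of_nat (Suc j) * \<phi> (Suc j) else 0)
      + fps_const c * fps_X * (if j = 0 then 0 else of_nat (d - (j - 1)) * \<phi> (j - 1)):] * ?M j)"
    unfolding G_def E_sum E_monomial sum.distrib down up
    unfolding sum.distrib[symmetric] distrib_right[symmetric] by simp
  also have "\<dots> = (\<Sum>j\<le>d. [:of_nat d * L * \<phi> j:] * ?M j)"
  proof (intro sum.cong refl)
    fix j assume "j \<in> {..d}"
    then have "fps_X ^ 2 * fps_deriv (\<phi> j) + 2 * of_nat j * L * \<phi> j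
      + fps_const b * fps_X * (if j < d then of_nat (Suc j) * \<phi> (Suc j) else 0)
      + fps_const c * fps_X * (if j = 0 then 0 else of_nat (d - (j - 1)) * \<phi> (j - 1)) = of_nat d * L * \<phi> j"
      (is "?A = _")
      using pde[of j] by (simp add: algebra_simps)
    then show "[:?A:] * ?M j = [:of_nat d * L * \<phi> j:] * ?M j"
      by (simp only:)
  qed
  also have "\<dots> = smult (of_nat d * L) G"
    by (simp add: G_def poly_eq_iff coeff_sum sum_distrib_left mult.assoc)
  finally show ?thesis .
qed

text \<open>The coefficient of S^k satisfies an irregular equation with leading constant d - 2k,
  which has no nonzero power series solution.\<close>

lemma coeff_G_eq_0:
  assumes "2 * k \<noteq> d"
  shows "coeff G k = 0"
proof (rule fps_irregular_ode_eq_0)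
  have "fps_X ^ 2 * fps_deriv (coeff G k) = (of_nat d - 2 * of_nat k) * L * coeff G k"
    using arg_cong[OF E_G, of "\<lambda>P. coeff P k"] by (simp add: coeff_E algebra_simps)
  also have "(of_nat d - 2 * of_nat k :: complex fps) = fps_const (of_nat d - 2 * of_nat k)"
    by (simp add: fps_of_nat fps_numeral_fps_const flip: fps_const_sub fps_const_mult)
  finally show "fps_X ^ 2 * fps_deriv (coeff G k) =
      fps_const (of_nat d - 2 * of_nat k) * L * coeff G k" .
  have "of_nat d \<noteq> (of_nat (2 * k) :: complex)"
    using assms by (metis of_nat_eq_iff)
  then show "of_nat d - 2 * of_nat k \<noteq> (0 :: complex)" by simp
qed

text \<open>For d = 2k the two multiples of \<open>L\<close> cancel, leaving only the
  derivative.\<close>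

lemma coeff_G_const:
  assumes "2 * k = d"
  shows "coeff G k = fps_const (fps_nth (coeff G k) 0)"
proof -
  have "of_nat d = (2 * of_nat k :: complex fps)"
    using assms by auto
  then have "fps_deriv (coeff G k) = 0"
    using arg_cong[OF E_G, of "\<lambda>P. coeff P k"] by (simp add: coeff_E)
  then show ?thesis by (simp only: fps_deriv_eq_0_iff)
qed

text \<open>
  \<open>(y, 1) = (u - v y) (Y1(S), Y2(S))\<close> for \<open>S = (q y - p) / (u - v y)\<close>.
\<close>

lemma form_eq_G:
  fixes y :: "complex fps"
  defines "l1 \<equiv> u - v * y" and "l2 \<equiv> q * y - p"
  shows "(\<Sum>j\<le>d. \<phi> j * y ^ j) = l1 ^ d * poly G (l2 * inverse l1)"
proof -
  define S where "S = l2 * inverse l1"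
  have "fps_nth l1 0 \<noteq> 0" by (simp add: l1_def)
  then have inv: "l1 * inverse l1 = 1"
    by (simp add: inverse_mult_eq_1')
  have lS: "l1 * S = l2"
    unfolding S_def using inv by (metis mult.left_commute mult.right_neutral)
  have Y1: "l1 * poly Y1 S = y"
  proof -
    have "l1 * poly Y1 S = l1 * p + l1 * S * u"
      by (simp add: Y1_def algebra_simps)
    also have "\<dots> = (u * q - p * v) * y"
      unfolding lS by (simp add: l1_def l2_def algebra_simps)
    finally show ?thesis by (simp add: wronskian)
  qed
  have Y2: "l1 * poly Y2 S = 1"
  proof -
    have "l1 * poly Y2 S = l1 * q + l1 * S * v"
      by (simp add: Y2_def algebra_simps)
    also have "\<dots> = u * q - p * v"
      unfolding lS by (simp add: l1_def l2_def algebra_simps)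
    finally show ?thesis by (simp add: wronskian)
  qed
  have "l1 ^ d * poly G S = (\<Sum>j\<le>d. l1 ^ d * (\<phi> j * (poly Y1 S ^ j * poly Y2 S ^ (d - j))))"
    by (simp add: G_def poly_sum poly_power sum_distrib_left)
  also have "\<dots> = (\<Sum>j\<le>d. \<phi> j * y ^ j)"
  proof (intro sum.cong refl)
    fix j assume "j \<in> {..d}"
    then have "l1 ^ d = l1 ^ j * l1 ^ (d - j)" by (simp flip: power_add)
    then have "l1 ^ d * (\<phi> j * (poly Y1 S ^ j * poly Y2 S ^ (d - j))) =
        \<phi> j * ((l1 * poly Y1 S) ^ j * (l1 * poly Y2 S) ^ (d - j))"
      by (simp add: power_mult_distrib)
    then show "l1 ^ d * (\<phi> j * (poly Y1 S ^ j * poly Y2 S ^ (d - j))) = \<phi> j * y ^ j"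
      by (simp only: Y1 Y2) simp
  qed
  finally show ?thesis by (simp add: S_def)
qed

text \<open>Only the middle coefficient of \<open>G\<close> survives, so \<open>G\<close> is C S^m,
  and l1^(2m) (l2 / l1)^m = (l1 l2)^m.\<close>

lemma form_eq_power_h:
  assumes "j0 \<le> d" "\<phi> j0 \<noteq> 0"
  obtains m C where "d = 2 * m" "C \<noteq> 0" "\<And>y. (\<Sum>j\<le>d. \<phi> j * y ^ j) = fps_const C * h y ^ m"
proof -
  have "G \<noteq> 0"
  proof
    assume "G = 0"
    \<comment> \<open>If \<open>G\<close> were 0, the form, read as a polynomial in y, would vanish
      at every power series.\<close>
    define P where "P = (\<Sum>j\<le>d. monom (\<phi> j) j)"
    have "poly P y = 0" for y
      using form_eq_G[of y] \<open>G = 0\<close> by (simp add: P_def poly_sum poly_monom)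
    moreover have "infinite (UNIV :: complex fps set)"
    proof -
      have "inj (fps_const :: complex \<Rightarrow> complex fps)"
        by (simp add: inj_on_def)
      then have "infinite (range (fps_const :: complex \<Rightarrow> complex fps))"
        by (simp add: finite_image_iff infinite_UNIV_char_0)
      then show ?thesis
        by (rule infinite_super[rotated]) simp
    qed
    ultimately have "P = 0"
      using poly_roots_finite[of P] by auto
    moreover have "coeff P j0 = \<phi> j0"
      using assms(1) by (simp add: P_def coeff_sum if_distrib sum.delta)
    ultimately show False using assms(2) by simp
  qed
  then obtain m where m: "coeff G m \<noteq> 0"
    by (meson leading_coeff_neq_0)
  then have d: "d = 2 * m" using coeff_G_eq_0[of m] by auto
  define C where "C = fps_nth (coeff G m) 0"
  have C: "coeff G m = fps_const C"
    unfolding C_def by (rule coeff_G_const) (simp add: d)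
  have G: "G = monom (fps_const C) m"
  proof (rule poly_eqI)
    fix k
    show "coeff G k = coeff (monom (fps_const C) m) k"
      using C coeff_G_eq_0[of k] d by auto
  qed
  show thesis
  proof
    show "d = 2 * m" by (rule d)
    show "C \<noteq> 0" using C m by auto
    fix y
    define l1 where "l1 = u - v * y"
    define l2 where "l2 = q * y - p"
    have "fps_nth l1 0 \<noteq> 0" by (simp add: l1_def)
    then have inv: "l1 * inverse l1 = 1"
      by (simp add: inverse_mult_eq_1')
    have "(\<Sum>j\<le>d. \<phi> j * y ^ j) = l1 ^ d * (fps_const C * (l2 * inverse l1) ^ m)"
      using form_eq_G[of y] by (simp add: l1_def l2_def G poly_monom)
    also have "\<dots> = fps_const C * (l1 * l2 * (l1 * inverse l1)) ^ m"
      by (simp add: d power_mult power_mult_distrib power2_eq_square mult_ac)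
    also have "\<dots> = fps_const C * h y ^ m"
      unfolding inv by (simp add: h_def l1_def l2_def)
    finally show "(\<Sum>j\<le>d. \<phi> j * y ^ j) = fps_const C * h y ^ m" .
  qed
qed

end

section \<open>From convergence of h to convergence of u\<close>

text \<open>As \<open>h\<close> is quadratic in y, its values at 1, -1 and 2 recover two of its
  coefficients, which determine u' / u by the Wronskian identity. The condition on t fits the m-th
  root argument: t is the constant term of \<open>h (fps_const t)\<close>.\<close>

lemma h_convergent_imp_u_convergent:
  assumes conv: "\<And>t. t \<noteq> 0 \<Longrightarrow> fps_conv_radius (h (fps_const t)) > 0"
  shows "fps_conv_radius u > 0"
proof -
  define \<alpha> where "\<alpha> = - (v * q)"
  define \<beta> where "\<beta> = u * q + p * v"
  have h_t: "h (fps_const t) = \<alpha> * fps_const (t * t) + \<beta> * fps_const t - u * p" for t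
    by (simp add: h_def \<alpha>_def \<beta>_def algebra_simps flip: fps_const_mult)
  have scale: "fps_conv_radius (fps_const t * f) > 0" if "fps_conv_radius f > 0" for t and f :: "complex fps"
    using that by (intro fps_conv_radius_pos_combine) auto
  have "\<beta> = fps_const (1/2) * (h (fps_const 1) - h (fps_const (-1)))"
    unfolding h_t by (rule fps_ext) simp
  then have \<beta>_conv: "fps_conv_radius \<beta> > 0"
    by (simp only:) (intro scale fps_conv_radius_pos_combine(2) conv; simp)
  have "\<alpha> = fps_const (1/3) * (h (fps_const 2) - h (fps_const 1) - \<beta>)"
    unfolding h_t by (rule fps_ext) simp
  then have \<alpha>_conv: "fps_conv_radius \<alpha> > 0"
    by (simp only:) (intro scale fps_conv_radius_pos_combine(2) conv \<beta>_conv; simp)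
  \<comment> \<open>\<open>W\<close> is u' / u = b v / (x u), expanded by 2 q: here 2 u q =
    \<open>\<beta> + 1\<close> and v q = \<open>- \<alpha>\<close>. The shift is an exact division
    by x, because \<open>v\<close> has constant term 0.\<close>
  define W where "W = fps_const (-2 * b) * fps_shift 1 \<alpha> * inverse (\<beta> + 1)"
  have nz: "fps_nth (\<beta> + 1) 0 \<noteq> 0" by (simp add: \<beta>_def)
  have "fps_conv_radius (\<beta> + 1) > 0"
    using \<beta>_conv by (intro fps_conv_radius_pos_combine) auto
  then have W_conv: "fps_conv_radius W > 0"
    unfolding W_def using \<alpha>_conv nz
    by (intro fps_conv_radius_pos_combine(3) fps_conv_radius_inverse_pos) auto
  have \<beta>1: "\<beta> + 1 = 2 * u * q"
    using wronskian unfolding \<beta>_def by algebra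
  have X\<alpha>: "fps_X * fps_shift 1 \<alpha> = \<alpha>"
    by (rule fps_ext) (auto simp: \<alpha>_def)
  have "fps_X * (\<beta> + 1) * fps_deriv u = 2 * u * q * (fps_X * fps_deriv u)"
    by (simp add: \<beta>1 mult_ac)
  also have "\<dots> = fps_const (-2 * b) * \<alpha> * u"
    by (simp add: u_ode \<alpha>_def mult_ac fps_numeral_fps_const flip: fps_const_mult fps_const_neg)
  also have "\<dots> = fps_X * (fps_const (-2 * b) * fps_shift 1 \<alpha> * u)"
    by (subst X\<alpha>[symmetric]) (simp add: mult_ac)
  finally have "(\<beta> + 1) * fps_deriv u = fps_const (-2 * b) * fps_shift 1 \<alpha> * u"
    by (simp add: mult.assoc)
  then have "inverse (\<beta> + 1) * (\<beta> + 1) * fps_deriv u = W * u"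
    by (simp add: W_def mult_ac)
  then have "fps_deriv u = W * u"
    by (simp only: inverse_mult_eq_1[OF nz] mult_1)
  then show ?thesis
    using W_conv by (rule fps_conv_radius_pos_linear_ode)
qed

end

section \<open>The vector field on coefficients of monomials in y\<close>

text \<open>Coefficient of \<open>y1^j y2^k\<close> as a series in x; this inverts the nesting of
  \<open>series3\<close>, where x is outermost.\<close>

definition slice :: "series3 \<Rightarrow> nat \<Rightarrow> nat \<Rightarrow> complex fps" where
  "slice F j k = Abs_fps (\<lambda>i. fps_nth (fps_nth (fps_nth F i) j) k)"

lemma series3_eqI:
  assumes "\<And>j k. slice F j k = slice H j k"
  shows "F = H"
proof (intro fps_ext)
  fix i j k
  show "fps_nth (fps_nth (fps_nth F i) j) k = fps_nth (fps_nth (fps_nth H i) j) k"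
    using arg_cong[OF assms[of j k], of "\<lambda>f. fps_nth f i"] by (simp add: slice_def)
qed

lemma slice_add: "slice (F + H) j k = slice F j k + slice H j k"
  and slice_minus: "slice (- F) j k = - slice F j k"
  and slice_0 [simp]: "slice 0 j k = 0"
  by (simp_all add: slice_def fps_eq_iff)

lemma slice_var_x: "slice (var_x * F) j k = fps_X * slice F j k"
  by (rule fps_ext) (simp add: slice_def var_x_def)

lemma slice_var_y1: "slice (var_y1 * F) j k = (if j = 0 then 0 else slice F (j - 1) k)"
  by (rule fps_ext) (simp add: slice_def var_y1_def)

lemma slice_var_y2: "slice (var_y2 * F) j k = (if k = 0 then 0 else slice F j (k - 1))"
  by (rule fps_ext) (simp add: slice_def var_y2_def)

lemma slice_const3: "slice (const3 t * F) j k = fps_const t * slice F j k"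
  by (rule fps_ext) (simp add: slice_def const3_def)

lemma fps_nth_of_nat_mult:
  fixes f :: "'a :: comm_ring_1 fps"
  shows "fps_nth (of_nat n * f) m = of_nat n * fps_nth f m"
  by (simp flip: fps_of_nat)

lemma slice_d_x: "slice (d_x F) j k = fps_deriv (slice F j k)"
proof (rule fps_ext)
  fix i
  show "fps_nth (slice (d_x F) j k) i = fps_nth (fps_deriv (slice F j k)) i"
    by (simp only: slice_def d_x_def fps_deriv_nth fps_nth_of_nat_mult fps_nth_Abs_fps)
qed

lemma slice_d_y1: "slice (d_y1 F) j k = of_nat (Suc j) * slice F (Suc j) k"
proof (rule fps_ext)
  fix i
  show "fps_nth (slice (d_y1 F) j k) i = fps_nth ((of_nat (Suc j) * slice F (Suc j) k)) i"
    by (simp only: slice_def d_y1_def fps_deriv_nth fps_nth_of_nat_mult fps_nth_Abs_fps Suc_eq_plus1)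
qed

lemma slice_d_y2: "slice (d_y2 F) j k = of_nat (Suc k) * slice F j (Suc k)"
proof (rule fps_ext)
  fix i
  show "fps_nth (slice (d_y2 F) j k) i = fps_nth ((of_nat (Suc k) * slice F j (Suc k))) i"
    by (simp only: slice_def d_y2_def fps_deriv_nth fps_nth_of_nat_mult fps_nth_Abs_fps Suc_eq_plus1)
qed

text \<open>The field preserves the degree in y, so the slices with fixed j + k satisfy a closed
  system of ordinary differential equations in x.\<close>

lemma slice_derivation:
  "slice (derivation (X_field a b c) F) j k =
     fps_X ^ 2 * fps_deriv (slice F j k)
     + (of_nat j - of_nat k) * (1 + fps_const a * fps_X) * slice F j k
     + fps_const b * fps_X * (if k = 0 then 0 else of_nat (Suc j) * slice F (Suc j) (k - 1))
     + fps_const c * fps_X * (if j = 0 then 0 else of_nat (Suc k) * slice F (j - 1) (Suc k))"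
proof -
  have eq: "derivation (X_field a b c) F = var_x * (var_x * d_x F)
      + (var_y1 * d_y1 F + const3 a * (var_x * (var_y1 * d_y1 F)))
      + const3 b * (var_x * (var_y2 * d_y1 F))
      + - (var_y2 * d_y2 F + const3 a * (var_x * (var_y2 * d_y2 F)))
      + const3 c * (var_x * (var_y1 * d_y2 F))"
    by (simp add: derivation_def X_field_def power2_eq_square algebra_simps)
  show ?thesis
    unfolding eq slice_add slice_minus slice_var_x slice_var_y1 slice_var_y2 slice_const3
      slice_d_x slice_d_y1 slice_d_y2
    by (cases j; cases k) (simp_all add: power2_eq_square algebra_simps flip: fps_const_neg)
qed

lemma fps_conv_radius_slice:
  assumes "convergent3 F"
  shows "fps_conv_radius (slice F j k) > 0"
proof -
  obtain r where r: "r > 0" and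
    sum: "(\<lambda>(i, j, k). norm (fps_nth (fps_nth (fps_nth F i) j) k) * r ^ (i + j + k)) summable_on UNIV"
    using assms by (auto simp: convergent3_def)
  define B where "B = (\<Sum>\<^sub>\<infinity>(i, j, k)\<in>UNIV. norm (fps_nth (fps_nth (fps_nth F i) j) k) * r ^ (i + j + k))"
  have "norm (fps_nth (fps_nth (fps_nth F i) j) k) * r ^ (i + j + k) \<le> B" for i
    unfolding B_def
    using finite_sum_le_infsum[OF sum, of "{(i, j, k)}"] r by auto
  then have "norm (fps_nth (slice F j k) i) \<le> B / r ^ (j + k) * (1 / r) ^ i" for i
    using r by (simp add: slice_def power_add field_simps)
  then show ?thesis
    using r by (intro fps_conv_radius_posI[of _ "B / r ^ (j + k)" "1 / r"]) auto
qed

section \<open>Formal and holomorphic first integrals\<close>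

context formal_fundamental_solution
begin

lemma formal_first_integral_exists:
  "\<exists>f. formal_first_integral (X_field a b c) f \<and> \<not> is_constant f"
proof -
  \<comment> \<open>The expansion of (u y1-free form) \<open>(u y2 - v y1) (q y1 - p y2)\<close>
    into its three quadratic monomials in y.\<close>
  define F where "F = Abs_fps (\<lambda>i. Abs_fps (\<lambda>j. Abs_fps (\<lambda>k.
    if j = 2 \<and> k = 0 then fps_nth (- (v * q)) i
    else if j = 1 \<and> k = 1 then fps_nth (u * q + p * v) i
    else if j = 0 \<and> k = 2 then fps_nth (- (u * p)) i else 0)))"
  have slice: "slice F j k =
    (if j = 2 \<and> k = 0 then - (v * q) else if j = 1 \<and> k = 1 then u * q + p * v
     else if j = 0 \<and> k = 2 then - (u * p) else 0)" for j k
    by (rule fps_ext) (simp add: slice_def F_def)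
  have u': "fps_X ^ 2 * fps_deriv u = fps_const b * fps_X * v"
    using arg_cong[OF u_ode, of "\<lambda>f. fps_X * f"] by (simp add: power2_eq_square mult_ac)
  have q': "fps_X ^ 2 * fps_deriv q = fps_const c * fps_X * p"
    using arg_cong[OF q_ode, of "\<lambda>f. fps_X * f"] by (simp add: power2_eq_square mult_ac)
  have prod: "fps_X ^ 2 * fps_deriv (f * g) = (fps_X ^ 2 * fps_deriv f) * g + f * (fps_X ^ 2 * fps_deriv g)"
    for f g :: "complex fps"
    by (simp add: algebra_simps)
  have D: "fps_X ^ 2 * fps_deriv (v * q) =
      (fps_const c * fps_X * u - 2 * L * v) * q + v * (fps_const c * fps_X * p)"
    "fps_X ^ 2 * fps_deriv (u * q) = fps_const b * fps_X * v * q + u * (fps_const c * fps_X * p)"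
    "fps_X ^ 2 * fps_deriv (p * v) =
      (fps_const b * fps_X * q + 2 * L * p) * v + p * (fps_const c * fps_X * u - 2 * L * v)"
    "fps_X ^ 2 * fps_deriv (u * p) =
      fps_const b * fps_X * v * p + u * (fps_const b * fps_X * q + 2 * L * p)"
    unfolding prod u' v_ode p_ode q' by (rule refl)+
  have "slice (derivation (X_field a b c) F) j k = 0" for j k
  proof -
    consider "j = 2" "k = 0" | "j = 1" "k = 1" | "j = 0" "k = 2" | "j + k \<noteq> 2"
      by linarith
    then show ?thesis
    proof cases
      case 1
      then show ?thesis using D(1) unfolding slice_derivation slice by (simp add: algebra_simps)
    next
      case 2
      have "slice (derivation (X_field a b c) F) 1 1 = fps_X ^ 2 * fps_deriv (u * q + p * v)
          + fps_const b * fps_X * (2 * - (v * q)) + fps_const c * fps_X * (2 * - (u * p))"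
        by (subst slice_derivation)
          (simp add: slice numeral_2_eq_2[symmetric] del: fps_deriv_mult fps_deriv_add)
      also have "\<dots> = 0"
        unfolding fps_deriv_add distrib_left D by (simp add: algebra_simps)
      finally show ?thesis by (simp only: 2)
    next
      case 3
      then show ?thesis using D(4) unfolding slice_derivation slice by (simp add: algebra_simps)
    next
      case 4
      then show ?thesis unfolding slice_derivation slice by auto
    qed
  qed
  then have "derivation (X_field a b c) F = 0"
    by (intro series3_eqI) simp
  moreover have "\<not> is_constant F"
  proof
    assume "is_constant F"
    then obtain t where "F = const3 t" by (auto simp: is_constant_def)
    then have "fps_nth (fps_nth (fps_nth F 0) 1) 1 = 0" by (simp add: const3_def)
    then show False by (simp add: F_def)
  qed
  ultimately show ?thesis by (auto simp: formal_first_integral_def)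
qed

text \<open>A nonzero component of positive degree in y is again a first integral, hence C h^m; its
  convergence passes to \<open>h\<close> at nonzero constants and from there to
  \<open>u\<close>.\<close>

lemma holomorphic_first_integral_imp_u_convergent:
  assumes "holomorphic_first_integral (X_field a b c) f" and "\<not> is_constant f"
  shows "fps_conv_radius u > 0"
proof -
  have conv: "convergent3 f" and deriv: "derivation (X_field a b c) f = 0"
    using assms(1) by (auto simp: holomorphic_first_integral_def)
  have pde: "fps_X ^ 2 * fps_deriv (slice f j k)
     + (of_nat j - of_nat k) * L * slice f j k
     + fps_const b * fps_X * (if k = 0 then 0 else of_nat (Suc j) * slice f (Suc j) (k - 1))
     + fps_const c * fps_X * (if j = 0 then 0 else of_nat (Suc k) * slice f (j - 1) (Suc k)) = 0" for j k
    using slice_derivation[of a b c f j k] by (simp add: deriv)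
  \<comment> \<open>Otherwise \<open>f\<close> would depend on x alone, and the equation in degree 0
    would make it constant.\<close>
  have "\<exists>j k. j + k > 0 \<and> slice f j k \<noteq> 0"
  proof (rule ccontr)
    assume "\<not> ?thesis"
    then have zero: "slice f j k = 0" if "j + k > 0" for j k using that by blast
    have "fps_deriv (slice f 0 0) = 0"
      using pde[of 0 0] by simp
    then have const: "slice f 0 0 = fps_const (fps_nth (slice f 0 0) 0)"
      by (simp only: fps_deriv_eq_0_iff)
    have "f = const3 (fps_nth (slice f 0 0) 0)"
    proof (rule series3_eqI)
      fix j k
      have "slice (const3 t) j k = (if j = 0 \<and> k = 0 then fps_const t else 0)" for t
        by (rule fps_ext) (auto simp: slice_def const3_def)
      then show "slice f j k = slice (const3 (fps_nth (slice f 0 0) 0)) j k"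
        using zero[of j k] const by auto
    qed
    then show False using assms(2) by (auto simp: is_constant_def)
  qed
  then obtain j0 k0 where jk: "j0 + k0 > 0" "slice f j0 k0 \<noteq> 0"
    by (elim exE conjE)
  define d where "d = j0 + k0"
  define \<phi> where "\<phi> j = slice f j (d - j)" for j
  have pde_\<phi>: "fps_X ^ 2 * fps_deriv (\<phi> j) + (2 * of_nat j - of_nat d) * L * \<phi> j
    + fps_const b * fps_X * (if j < d then of_nat (Suc j) * \<phi> (Suc j) else 0)
    + fps_const c * fps_X * (if j = 0 then 0 else of_nat (d - (j - 1)) * \<phi> (j - 1)) = 0"
    if "j \<le> d" for j
  proof -
    have 1: "(of_nat j - of_nat (d - j) :: complex fps) = 2 * of_nat j - of_nat d"
      using that by (simp add: of_nat_diff)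
    have 2: "(if d - j = 0 then 0 else of_nat (Suc j) * slice f (Suc j) (d - j - 1)) =
        (if j < d then of_nat (Suc j) * \<phi> (Suc j) else 0)"
      by (auto simp: \<phi>_def)
    have 3: "(if j = 0 then 0 else of_nat (Suc (d - j)) * slice f (j - 1) (Suc (d - j))) =
        (if j = 0 then 0 else of_nat (d - (j - 1)) * \<phi> (j - 1))"
      using that by (cases j) (auto simp: \<phi>_def Suc_diff_Suc simp del: of_nat_Suc)
    show ?thesis
      using pde[of j "d - j"] unfolding 1 2 3 by (simp only: \<phi>_def)
  qed
  obtain m C where m: "d = 2 * m" "C \<noteq> 0"
    and power_h: "\<And>y. (\<Sum>j\<le>d. \<phi> j * y ^ j) = fps_const C * h y ^ m"
    by (rule form_eq_power_h[OF pde_\<phi>, of j0]) (use jk in \<open>auto simp: d_def \<phi>_def\<close>)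
  show ?thesis
  proof (rule h_convergent_imp_u_convergent)
    fix t :: complex assume t: "t \<noteq> 0"
    have pow: "fps_conv_radius (fps_const t ^ j) > 0" for j
      by (simp add: fps_const_power)
    have "fps_conv_radius (\<Sum>j\<le>d. \<phi> j * fps_const t ^ j) > 0"
      using fps_conv_radius_slice[OF conv] pow unfolding \<phi>_def
      by (intro fps_conv_radius_pos_sum fps_conv_radius_pos_combine(3)) auto
    then have "fps_conv_radius (fps_const (1 / C) * (fps_const C * h (fps_const t) ^ m)) > 0"
      unfolding power_h by (intro fps_conv_radius_pos_combine(3)[of "fps_const (1 / C)"]) auto
    also have "fps_const (1 / C) * (fps_const C * h (fps_const t) ^ m) = h (fps_const t) ^ m"
      using m(2) by (simp flip: mult.assoc)
    finally have "fps_conv_radius (h (fps_const t) ^ m) > 0" .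
    moreover have "m > 0" using m jk by (auto simp: d_def)
    moreover have "fps_nth (h (fps_const t)) 0 \<noteq> 0"
      using t by (simp add: h_def)
    ultimately show "fps_conv_radius (h (fps_const t)) > 0"
      by (rule fps_conv_radius_pos_root)
  qed
qed

end

section \<open>Construction of the fundamental system and the cosine condition\<close>

text \<open>The first-order equations for \<open>u\<close> and \<open>q\<close> dictate the other
  two entries after division by b and c; the remaining equations are then
  \<open>formal_sol_ode\<close> for s = 1 and s = -1.\<close>

lemma formal_fundamental_solution_exists:
  fixes a b c :: complex
  assumes "b \<noteq> 0" "c \<noteq> 0"
  defines "u \<equiv> formal_sol 1 a (b * c)" and "q \<equiv> formal_sol (-1) a (b * c)"
  shows "formal_fundamental_solution a b c
    u (fps_const (1 / b) * (fps_X * fps_deriv u)) (fps_const (1 / c) * (fps_X * fps_deriv q)) q"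
proof
  have const: "fps_const t * (fps_const (1 / t) * f) = f" if "t \<noteq> 0" for t :: complex and f
    using that by (simp flip: mult.assoc)
  show "fps_X * fps_deriv u = fps_const b * (fps_const (1 / b) * (fps_X * fps_deriv u))"
    by (simp only: const[OF assms(1)])
  show "fps_X * fps_deriv q = fps_const c * (fps_const (1 / c) * (fps_X * fps_deriv q))"
    by (simp only: const[OF assms(2)])
  have const_deriv: "fps_X ^ 2 * fps_deriv (fps_const t * f) = fps_const t * (fps_X ^ 2 * fps_deriv f)"
    for t :: complex and f by (simp add: mult_ac)
  have split: "fps_const (b * c) = fps_const b * fps_const c" by simp
  show "fps_X ^ 2 * fps_deriv (fps_const (1 / b) * (fps_X * fps_deriv u)) =
      fps_const c * fps_X * u
      - 2 * (1 + fps_const a * fps_X) * (fps_const (1 / b) * (fps_X * fps_deriv u))"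
  proof -
    have "fps_X ^ 2 * fps_deriv (fps_const (1 / b) * (fps_X * fps_deriv u)) =
      fps_const (1 / b) * (fps_const (b * c) * fps_X * u
        - fps_const (2 * 1) * (1 + fps_const a * fps_X) * (fps_X * fps_deriv u))"
      unfolding const_deriv unfolding u_def by (subst formal_sol_ode) simp_all
    also have "\<dots> = fps_const b * (fps_const (1 / b) * (fps_const c * fps_X * u))
      - 2 * (1 + fps_const a * fps_X) * (fps_const (1 / b) * (fps_X * fps_deriv u))"
      unfolding split by (simp only: mult_1_right fps_numeral_fps_const) algebra
    finally show ?thesis by (simp only: const[OF assms(1)])
  qed
  show "fps_X ^ 2 * fps_deriv (fps_const (1 / c) * (fps_X * fps_deriv q)) =
      fps_const b * fps_X * q
      + 2 * (1 + fps_const a * fps_X) * (fps_const (1 / c) * (fps_X * fps_deriv q))"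
  proof -
    have neg: "fps_const (2 * - 1 :: complex) = - 2"
      by (simp add: fps_numeral_fps_const)
    have "fps_X ^ 2 * fps_deriv (fps_const (1 / c) * (fps_X * fps_deriv q)) =
      fps_const (1 / c) * (fps_const (b * c) * fps_X * q
        - fps_const (2 * - 1) * (1 + fps_const a * fps_X) * (fps_X * fps_deriv q))"
      unfolding const_deriv unfolding q_def by (subst formal_sol_ode) simp_all
    also have "\<dots> = fps_const c * (fps_const (1 / c) * (fps_const b * fps_X * q))
      + 2 * (1 + fps_const a * fps_X) * (fps_const (1 / c) * (fps_X * fps_deriv q))"
      unfolding split neg by algebra
    finally show ?thesis by (simp only: const[OF assms(2)])
  qed
qed (simp_all add: u_def q_def)

text \<open>Up to sign w is a + n, and cosine is even and 2 pi periodic.\<close>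

lemma cos_2pi_of_square_eq:
  fixes a w :: complex
  assumes "w ^ 2 = (a + of_nat n) ^ 2"
  shows "cos (2 * of_real pi * a) = cos (2 * of_real pi * w)"
proof -
  have "cos (2 * of_real pi * w) = cos (2 * of_real pi * (a + of_nat n))"
    using assms unfolding power2_eq_iff by (elim disjE) (simp_all only: mult_minus_right cos_minus)
  also have "2 * of_real pi * (a + of_nat n) = 2 * of_real pi * a + of_nat n * (2 * of_real pi)"
    by (simp add: algebra_simps)
  also have "cos \<dots> = cos (2 * of_real pi * a)"
    by (rule cos.plus_of_nat)
  finally show ?thesis ..
qed

theorem theorem1p1:
  fixes a b c :: complex
  assumes "cos (2 * of_real pi * a) \<noteq> cos (2 * of_real pi * csqrt (a ^ 2 + b * c))"
  shows "\<not> (\<exists>f. holomorphic_first_integral (X_field a b c) f \<and> \<not> is_constant f) \<and>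
         (\<exists>f. formal_first_integral (X_field a b c) f \<and> \<not> is_constant f)"
proof -
  \<comment> \<open>The expression equals (a^2 + b c) - (a + n)^2; if it vanished, the two cosines
    would agree.\<close>
  have nz: "b * c - 2 * a * of_nat n - of_nat n ^ 2 \<noteq> 0" for n
  proof
    assume "b * c - 2 * a * of_nat n - of_nat n ^ 2 = 0"
    then have "csqrt (a ^ 2 + b * c) ^ 2 = (a + of_nat n) ^ 2"
      by (simp add: power2_sum algebra_simps)
    from cos_2pi_of_square_eq[OF this] assms show False by simp
  qed
  \<comment> \<open>The case n = 0 says that b c is nonzero.\<close>
  have "b \<noteq> 0" "c \<noteq> 0" using nz[of 0] by auto
  then interpret formal_fundamental_solution a b c "formal_sol 1 a (b * c)"
    "fps_const (1 / b) * (fps_X * fps_deriv (formal_sol 1 a (b * c)))"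
    "fps_const (1 / c) * (fps_X * fps_deriv (formal_sol (-1) a (b * c)))" "formal_sol (-1) a (b * c)"
    by (rule formal_fundamental_solution_exists)
  have "fps_conv_radius (formal_sol 1 a (b * c)) = 0"
    by (rule fps_conv_radius_formal_sol) (use nz in auto)
  then have "\<not> (\<exists>f. holomorphic_first_integral (X_field a b c) f \<and> \<not> is_constant f)"
    using holomorphic_first_integral_imp_u_convergent by (metis less_irrefl)
  then show ?thesis
    using formal_first_integral_exists by blast
qed

end
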